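(* Let $\lambda>-1$, and for $t>0$ let $\alpha_n(t)$, $\beta_n(t)$ be the recurrence coefficients of the monic orthogonal polynomials with respect to the weight $w(x;t)=x^{\lambda}e^{-x^3-t/x}$ on $(0,\infty)$. Then, for every $n\ge1$ and every $t>0$, they satisfy the coupled differential-difference equations $$t\alpha_n'(t)=\alpha_n+3\beta_n(\alpha_n^2+\alpha_n\alpha_{n-1}+\alpha_{n-1}^2+\beta_n+\beta_{n-1})-3\beta_{n+1}(\alpha_{n+1}^2+\alpha_{n+1}\alpha_{n}+\alpha_{n}^2+\beta_{n+2}+\beta_{n+1}),$$ $$t\beta_n'(t)=\beta_n\left[2+3\alpha_{n-2}\beta_{n-1}-3\alpha_{n+1}\beta_{n+1}+3\alpha_{n-1}(\alpha_{n-1}^2+\beta_n+2\beta_{n-1})-3\alpha_{n}(\alpha_{n}^2+\beta_n+2\beta_{n+1})\right],$$ where primes denote derivatives with respect to $t$.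
   Context: For $\lambda>-1$, $t>0$ let $w(x;t)=x^{\lambda}e^{-x^3-t/x}$, $x\in(0,\infty)$. Let $P_n(x;t)$, $n=0,1,2,\dots$, be the monic polynomials of degree $n$ with $\int_0^\infty P_m(x;t)P_n(x;t)w(x;t)\,dx=h_n(t)\delta_{mn}$, $h_n(t)>0$. The recurrence coefficients $\alpha_n$ ($n\ge0$) and $\beta_n$ ($n\ge 1$) are defined by $xP_n(x;t)=P_{n+1}(x;t)+\alpha_n(t)P_n(x;t)+\beta_n(t)P_{n-1}(x;t)$, with $P_0=1$ and $\beta_0P_{-1}=0$; equivalently $\alpha_n=\frac1{h_n}\int_0^\infty xP_n^2w\,dx$ and $\beta_n=h_n/h_{n-1}$. Convention: $\beta_0=0$, and any term containing the factor $\beta_0$ is $0$ (in particular $\alpha_{-1}\beta_0=0$). *)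

theory Defs
  imports "HOL-Analysis.Analysis" "HOL-Computational_Algebra.Polynomial"
begin

definition weight :: "real \<Rightarrow> real \<Rightarrow> real \<Rightarrow> real" where
  "weight lam t x = x powr lam * exp (- (x ^ 3) - t / x)"

text \<open>
  A Bochner integral is \<open>0\<close> for a non-integrable function. This case does not arise for
  \<open>weight lam t\<close> with \<open>t > 0\<close>: all polynomials are integrable against it on the half line.
\<close>

definition monic_orthogonal_polys ::
    "(real \<Rightarrow> real) \<Rightarrow> (nat \<Rightarrow> real poly) \<Rightarrow> (nat \<Rightarrow> real) \<Rightarrow> bool" where
  "monic_orthogonal_polys w P h \<longleftrightarrow>
     (\<forall>n. degree (P n) = n \<and> lead_coeff (P n) = 1) \<and>
     (\<forall>n. h n > 0) \<and>
     (\<forall>m n. (LINT x:{0<..}|lborel. poly (P m) x * poly (P n) x * w x)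
              = (if m = n then h n else 0))"

text \<open>
  The clause \<open>\<beta> 0 = 0\<close> is the convention that every term with a factor \<open>\<beta> 0\<close> vanishes.
  It also makes truncated subtraction harmless: wherever an index \<open>n - 1\<close> or \<open>n - 2\<close>
  would be negative, the term carries the factor \<open>\<beta> 0\<close>.
\<close>

definition recurrence_coeffs ::
    "(nat \<Rightarrow> real poly) \<Rightarrow> (nat \<Rightarrow> real) \<Rightarrow> (nat \<Rightarrow> real) \<Rightarrow> bool" where
  "recurrence_coeffs P \<alpha> \<beta> \<longleftrightarrow>
     \<beta> 0 = 0 \<and>
     (\<forall>n. [:0, 1:] * P n = P (n + 1) + smult (\<alpha> n) (P n) + smult (\<beta> n) (P (n - 1)))"

end

theory Submission
  imports Defs "HOL-Real_Asymp.Real_Asymp"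
begin

text \<open>
  Write \<open>L\<^sub>t p\<close> for the integral of \<open>p w\<close> over the half line. Differentiating under the integral sign gives
  \<open>L\<^sub>t' p = - \<integral> (p / x) w\<close>, which involves a negative power of \<open>x\<close>; but integrating the derivative of \<open>x p w\<close>
  over the half line expresses exactly this integral by polynomials,
  \<open>t L\<^sub>t' p = L\<^sub>t ((lam + 1) p + x p' - 3 x\<^sup>3 p)\<close>. This is the combination of a scaling flow, due to \<open>x d/dx\<close>,
  and a Toda-like flow with Hamiltonian \<open>x\<^sup>3\<close>, and besides integrability it is all that is
  used about the weight (\<open>weighted_integral_has_derivative\<close>).

  The recurrence coefficients are differentiable because each polynomial arises from its predecessors by
  rational operations on their moments (\<open>P_differentiable\<close>). Differentiating the orthogonality relations
  for \<open>P\<^sub>n P\<^sub>n\<close> and \<open>P\<^sub>n P\<^bsub>n-1\<^esub>\<close> and using that the parameter derivative of \<open>P\<^sub>n\<close> has lower degree yields,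
  with \<open>p\<^sub>n\<close> the coefficient of \<open>x\<^bsup>n-1\<^esup>\<close> in \<open>P\<^sub>n\<close>,
  \<open>t h\<^sub>n' = (lam + 1 + 2 n) h\<^sub>n - 3 L\<^sub>t (x\<^sup>3 P\<^sub>n P\<^sub>n)\<close> (\<open>h_has_derivative\<close>) and
  \<open>t p\<^sub>n' = p\<^sub>n + 3 L\<^sub>t (x\<^sup>3 P\<^sub>n P\<^bsub>n-1\<^esub>) / h\<^bsub>n-1\<^esub>\<close> (\<open>subleading_has_derivative\<close>).
  The remaining integrals are entries of the cube of the tridiagonal matrix of the recurrence
  (\<open>L_X3_P_P\<close>, \<open>L_X3_P_P_Suc\<close>). The two equations follow from \<open>\<beta>\<^sub>n = h\<^sub>n / h\<^bsub>n-1\<^esub>\<close> and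
  \<open>\<alpha>\<^sub>n = p\<^sub>n - p\<^bsub>n+1\<^esub>\<close>.
\<close>

section \<open>The flow operator\<close>

text \<open>
  The velocity of the moment functional: \<open>t d/dt L\<^sub>t p = L\<^sub>t (flow_op lam p)\<close>. It arises from the derivative of
  \<open>x p w\<close>; the cube comes from the exponent \<open>- x\<^sup>3\<close> of the weight.
\<close>

definition flow_op :: "real \<Rightarrow> real poly \<Rightarrow> real poly" where
  "flow_op lam p = smult (lam + 1) p + [:0, 1:] * pderiv p - smult 3 (monom 1 3 * p)"

lemma flow_op_add: "flow_op lam (p + q) = flow_op lam p + flow_op lam q"
  by (simp add: flow_op_def pderiv_add smult_add_right distrib_left)

lemma flow_op_smult: "flow_op lam (smult c p) = smult c (flow_op lam p)"
  by (simp add: flow_op_def pderiv_smult smult_add_right smult_diff_right mult.commute)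

lemma flow_op_0: "flow_op lam 0 = 0"
  by (simp add: flow_op_def)

lemma flow_op_sum: "flow_op lam (\<Sum>i\<in>A. f i) = (\<Sum>i\<in>A. flow_op lam (f i))"
  by (induction A rule: infinite_finite_induct) (simp_all add: flow_op_0 flow_op_add)

lemma degree_X_pderiv: "degree ([:0, 1:] * pderiv p) \<le> degree (p :: real poly)"
  by (rule degree_le) (auto simp: coeff_pCons coeff_pderiv coeff_eq_0 split: nat.split)

lemma coeff_X_pderiv: "coeff ([:0, 1:] * pderiv p) n = of_nat n * coeff (p :: real poly) n"
  by (cases n) (auto simp: coeff_pderiv)

section \<open>Moments of the weight and their dependence on the parameter\<close>

lemma set_integrable_powr_exp:
  fixes a :: real
  assumes "a > -1"
  shows "set_integrable lborel {0<..} (\<lambda>x. x powr a * exp (- x))"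
proof -
  have "(\<lambda>x. x powr a / exp x) integrable_on {0..}"
    using Gamma_integral_real[of "a + 1"] assms by (auto simp: has_integral_iff)
  then have "(\<lambda>x. x powr a / exp x) absolutely_integrable_on {0..}"
    by (subst absolutely_integrable_on_iff_nonneg) auto
  then have "(\<lambda>x. x powr a * exp (- x)) absolutely_integrable_on {0<..}"
    by (rule set_integrable_subset[THEN set_integrable_cong[THEN iffD1, rotated 3]])
       (auto simp: exp_minus field_simps)
  then show ?thesis
    unfolding set_integrable_def by (subst (asm) integrable_completion) auto
qed

lemma weight_nonneg: "weight lam t x \<ge> 0"
  by (simp add: weight_def)

lemma weight_measurable [measurable]: "weight lam t \<in> borel_measurable borel"
  unfolding weight_def by measurable

lemma poly_measurable [measurable]: "poly (p :: real poly) \<in> borel_measurable borel"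
  by (intro borel_measurable_continuous_onI continuous_intros)

text \<open>
  Domination by a Gamma density gives integrability: the cube beats \<open>x - 1\<close>, and \<open>exp (- t / x) \<le> 1\<close>.
\<close>

lemma weight_le_Gamma:
  assumes "t > 0" "x > 0"
  shows "weight lam t x \<le> exp 1 * (x powr lam * exp (- x))"
proof -
  have "x - 1 \<le> x ^ 3"
  proof (cases "x \<le> 1")
    case False
    then have "x ^ 1 \<le> x ^ 3" by (intro power_increasing) auto
    then show ?thesis by simp
  qed (use assms zero_less_power[of x 3] in linarith)
  then have "exp (- (x ^ 3) - t / x) \<le> exp (1 + - x)"
    using assms by (simp add: algebra_simps)
      (smt (verit) divide_pos_pos)
  then have "weight lam t x \<le> x powr lam * exp (1 + - x)"
    unfolding weight_def by (rule mult_left_mono) simp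
  then show ?thesis by (simp only: exp_add mult_ac)
qed

lemma set_integrable_power_weight:
  assumes "lam > -1" "t > 0"
  shows "set_integrable lborel {0<..} (\<lambda>x. x ^ i * weight lam t x)"
proof (rule set_integrable_bound)
  show "set_integrable lborel {0<..} (\<lambda>x. exp 1 * (x powr (lam + real i) * exp (- x)))"
    using assms by (intro set_integrable_mult_right set_integrable_powr_exp) auto
  have "norm (x ^ i * weight lam t x) \<le> norm (exp 1 * (x powr (lam + real i) * exp (- x)))"
    if "x > 0" for x
  proof -
    have "x ^ i * weight lam t x \<le> x ^ i * (exp 1 * (x powr lam * exp (- x)))"
      using weight_le_Gamma[OF assms(2) that] that by (intro mult_left_mono) auto
    also have "\<dots> = exp 1 * (x powr (lam + real i) * exp (- x))"
      using that by (simp add: powr_add powr_realpow)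
    finally show ?thesis using that by (simp add: weight_nonneg)
  qed
  then show "AE x in lborel. x \<in> {0<..} \<longrightarrow>
      norm (x ^ i * weight lam t x) \<le> norm (exp 1 * (x powr (lam + real i) * exp (- x)))"
    by auto
qed (simp_all add: set_borel_measurable_def)

lemma set_integrable_poly_weight:
  assumes "lam > -1" "t > 0"
  shows "set_integrable lborel {0<..} (\<lambda>x. poly p x * weight lam t x)"
proof -
  have "set_integrable lborel {0<..} (\<lambda>x. \<Sum>i\<le>degree p. coeff p i * (x ^ i * weight lam t x))"
    using set_integrable_power_weight[OF assms]
    unfolding set_integrable_def scaleR_sum_right
    by (intro Bochner_Integration.integrable_sum set_integrable_mult_right[unfolded set_integrable_def])
  then show ?thesis by (simp add: poly_altdef sum_distrib_right mult.assoc)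
qed

text \<open>
  Differentiating in the parameter produces a factor \<open>1 / x\<close>, and \<open>x powr lam / x\<close> may fail to be integrable at
  \<open>0\<close>. Half of the exponent \<open>s / x\<close> absorbs this factor, because \<open>y \<le> exp y\<close>. The bound is uniform for
  \<open>t \<ge> s\<close>, so that it also dominates difference quotients.
\<close>

lemma weight_divide_le:
  assumes "s > 0" "s \<le> t" "x > 0"
  shows "weight lam t x / x \<le> 2 / s * weight lam (s / 2) x"
proof -
  have "s / (2 * x) \<le> exp (s / (2 * x))"
    using exp_ge_add_one_self[of "s / (2 * x)"] by linarith
  then have "1 / x \<le> 2 / s * exp (s / (2 * x))"
    using assms by (simp add: field_simps)
  then have "weight lam t x * (1 / x) \<le> weight lam t x * (2 / s * exp (s / (2 * x)))"
    by (intro mult_left_mono weight_nonneg)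
  also have "weight lam t x * exp (s / (2 * x)) \<le> weight lam (s / 2) x"
  proof -
    have "s / x \<le> t / x" using assms by (intro divide_right_mono) auto
    then have "exp (- (x ^ 3) - t / x + s / (2 * x)) \<le> exp (- (x ^ 3) - s / 2 / x)"
      using assms by (simp add: field_simps)
    then show ?thesis unfolding weight_def mult.assoc exp_add[symmetric]
      by (intro mult_left_mono) auto
  qed
  then have "weight lam t x * (2 / s * exp (s / (2 * x))) \<le> 2 / s * weight lam (s / 2) x"
    using assms by (simp add: field_simps)
  finally show ?thesis by simp
qed

lemma set_integrable_poly_weight_divide:
  assumes "lam > -1" "t > 0"
  shows "set_integrable lborel {0<..} (\<lambda>x. poly p x * (weight lam t x / x))"
proof (rule set_integrable_bound)
  show "set_integrable lborel {0<..} (\<lambda>x. 2 / t * (poly p x * weight lam (t / 2) x))"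
    using assms by (intro set_integrable_mult_right set_integrable_poly_weight) auto
  have "\<bar>poly p x\<bar> * (weight lam t x / x) \<le> \<bar>poly p x\<bar> * (2 / t * weight lam (t / 2) x)" if "x > 0" for x
    using assms that by (intro mult_left_mono weight_divide_le) auto
  then show "AE x in lborel. x \<in> {0<..} \<longrightarrow>
      norm (poly p x * (weight lam t x / x)) \<le> norm (2 / t * (poly p x * weight lam (t / 2) x))"
    using assms by (auto simp: abs_mult weight_nonneg mult_ac)
qed (simp add: set_borel_measurable_def)

lemma weight_has_derivative_param:
  assumes "x > 0"
  shows "((\<lambda>s. weight lam s x) has_real_derivative - (weight lam s x / x)) (at s)"
  unfolding weight_def using assms by (auto intro!: derivative_eq_intros)

lemma weight_diff_quotient_bound:
  assumes "s > r" "t > r" "r > 0" "x > 0" "s \<noteq> t"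
  shows "\<bar>(weight lam s x - weight lam t x) / (s - t)\<bar> \<le> 2 / r * weight lam (r / 2) x"
proof -
  have "norm (weight lam s x - weight lam t x) \<le> 2 / r * weight lam (r / 2) x * norm (s - t)"
  proof (rule field_differentiable_bound[of "{r<..}"])
    show "((\<lambda>s. weight lam s x) has_field_derivative - (weight lam u x / x)) (at u within {r<..})" for u
      using weight_has_derivative_param[OF \<open>x > 0\<close>] by (rule has_field_derivative_at_within)
    show "norm (- (weight lam u x / x)) \<le> 2 / r * weight lam (r / 2) x" if "u \<in> {r<..}" for u
      using weight_divide_le[of r u x lam] assms that weight_nonneg[of lam u x] by simp
  qed (use assms in auto)
  then show ?thesis using assms by (simp add: divide_le_eq)
qed

text \<open>
  Differentiation under the integral sign, by dominated convergence along sequences. Restricting the parameter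
  to \<open>s > t / 2\<close> makes one dominating function serve for all difference quotients.
\<close>

lemma moment_has_derivative_param:
  assumes lam: "lam > -1" and t: "t > 0"
  shows "((\<lambda>s. LINT x:{0<..}|lborel. poly p x * weight lam s x) has_real_derivative
            - (LINT x:{0<..}|lborel. poly p x * (weight lam t x / x))) (at t)"
proof -
  define I where "I s = (LINT x:{0<..}|lborel. poly p x * weight lam s x)" for s
  define r where "r = t / 2"
  have r: "r > 0" "r < t" using t by (auto simp: r_def)
  have "((\<lambda>s. (I s - I t) / (s - t)) \<longlongrightarrow> (LINT x:{0<..}|lborel. - (poly p x * (weight lam t x / x))))
          (at t within {r<..})"
    unfolding tendsto_at_iff_sequentially comp_def
  proof (intro allI impI)
    fix X assume X: "\<forall>i. X i \<in> {r<..} - {t}" "X \<longlonglongrightarrow> t"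
    define q where "q i x = poly p x * ((weight lam (X i) x - weight lam t x) / (X i - t))" for i x
    have "(I (X i) - I t) / (X i - t) = (LINT x:{0<..}|lborel. q i x)" for i
    proof -
      have "X i > 0" using X(1) r by (metis DiffD1 greaterThan_iff less_trans)
      then have "I (X i) - I t = (LINT x:{0<..}|lborel. poly p x * weight lam (X i) x - poly p x * weight lam t x)"
        unfolding I_def by (intro set_integral_diff(2)[symmetric] set_integrable_poly_weight lam t)
      then show ?thesis
        by (simp add: q_def right_diff_distrib flip: set_integral_divide_zero)
    qed
    moreover have "(\<lambda>i. LINT x:{0<..}|lborel. q i x) \<longlonglongrightarrow>
        (LINT x:{0<..}|lborel. - (poly p x * (weight lam t x / x)))"
      unfolding set_lebesgue_integral_def
    proof (rule integral_dominated_convergence)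
      show "integrable lborel (\<lambda>x. indicator {0<..} x *\<^sub>R (\<bar>2 / r * (poly p x * weight lam (r / 2) x)\<bar>))"
        using set_integrable_poly_weight[OF lam, of "r / 2" p] r
        by (intro set_integrable_abs[unfolded set_integrable_def]
            set_integrable_mult_right[unfolded set_integrable_def]) (auto simp: set_integrable_def)
      show "AE x in lborel. (\<lambda>i. indicator {0<..} x *\<^sub>R q i x) \<longlonglongrightarrow>
              indicator {0<..} x *\<^sub>R - (poly p x * (weight lam t x / x))"
      proof (rule AE_I2)
        fix x :: real
        show "(\<lambda>i. indicator {0<..} x *\<^sub>R q i x) \<longlonglongrightarrow>
              indicator {0<..} x *\<^sub>R - (poly p x * (weight lam t x / x))"
        proof (cases "x > 0")
          case True
          have "(\<lambda>i. (weight lam (X i) x - weight lam t x) / (X i - t)) \<longlonglongrightarrow> - (weight lam t x / x)"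
            using weight_has_derivative_param[OF True, of lam t] X
            unfolding has_field_derivative_iff tendsto_at_iff_sequentially comp_def by auto
          then have "(\<lambda>i. q i x) \<longlonglongrightarrow> poly p x * - (weight lam t x / x)"
            unfolding q_def by (rule tendsto_mult_left)
          then show ?thesis using True by simp
        qed simp
      qed
      show "AE x in lborel. norm (indicator {0<..} x *\<^sub>R q i x)
              \<le> indicator {0<..} x *\<^sub>R \<bar>2 / r * (poly p x * weight lam (r / 2) x)\<bar>" for i
      proof (rule AE_I2)
        fix x :: real
        show "norm (indicator {0<..} x *\<^sub>R q i x)
              \<le> indicator {0<..} x *\<^sub>R \<bar>2 / r * (poly p x * weight lam (r / 2) x)\<bar>"
        proof (cases "x > 0")
          case True
          have "\<bar>poly p x\<bar> * \<bar>(weight lam (X i) x - weight lam t x) / (X i - t)\<bar>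
              \<le> \<bar>poly p x\<bar> * (2 / r * weight lam (r / 2) x)"
            using X r True by (intro mult_left_mono weight_diff_quotient_bound) auto
          then show ?thesis using True r
            by (simp add: q_def abs_mult weight_nonneg mult_ac)
        qed simp
      qed
    qed (simp_all add: q_def)
    ultimately show "(\<lambda>i. (I (X i) - I t) / (X i - t)) \<longlonglongrightarrow>
        (LINT x:{0<..}|lborel. - (poly p x * (weight lam t x / x)))"
      by simp
  qed
  then have "(I has_real_derivative (LINT x:{0<..}|lborel. - (poly p x * (weight lam t x / x)))) (at t)"
    using r by (simp add: has_field_derivative_iff at_within_open[of t "{r<..}"])
  then show ?thesis by (simp add: I_def[abs_def] set_lebesgue_integral_def)
qed

lemma weight_has_derivative:
  assumes "x > 0"
  shows "(weight lam t has_real_derivative (lam / x - 3 * x\<^sup>2 + t / x\<^sup>2) * weight lam t x) (at x)"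
  unfolding weight_def using assms
  by (auto intro!: derivative_eq_intros simp: field_simps powr_diff power2_eq_square)

text \<open>
  The primitive \<open>x p w\<close> vanishes at both ends of the half line, and \<open>x w' = (lam - 3 x\<^sup>3 + t / x) w\<close>. The
  factor \<open>x\<close> in the primitive is what makes the singular term match the parameter derivative.
\<close>

lemma moment_integration_by_parts:
  assumes lam: "lam > -1" and t: "t > 0"
  shows "(LINT x:{0<..}|lborel. poly (flow_op lam p) x * weight lam t x)
           = - t * (LINT x:{0<..}|lborel. poly p x * (weight lam t x / x))"
proof -
  define A where "A x = poly (flow_op lam p) x * weight lam t x" for x
  define B where "B x = t * (poly p x * (weight lam t x / x))" for x
  define F where "F x = x * poly p x * weight lam t x" for x
  have int: "set_integrable lborel {0<..} A" "set_integrable lborel {0<..} B"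
    unfolding A_def[abs_def] B_def[abs_def]
    by (intro set_integrable_poly_weight set_integrable_mult_right set_integrable_poly_weight_divide lam t)+
  have lims: "((\<lambda>x. x ^ i * (x * weight lam t x)) \<longlongrightarrow> 0) (at_right 0)"
    "((\<lambda>x. x ^ i * (x * weight lam t x)) \<longlongrightarrow> 0) at_top" for i
    unfolding weight_def using lam t by real_asymp+
  have F_sum: "F x = (\<Sum>i\<le>degree p. coeff p i * (x ^ i * (x * weight lam t x)))" for x
    by (simp add: F_def poly_altdef sum_distrib_left sum_distrib_right mult_ac)
  have F_lims: "(F \<longlongrightarrow> 0) (at_right 0)" "(F \<longlongrightarrow> 0) at_top"
    unfolding F_sum[abs_def] by (intro tendsto_null_sum tendsto_mult_right_zero lims)+
  have "(LBINT x=0..\<infinity>. A x + B x) = 0 - 0"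
  proof (rule interval_integral_FTC_integrable)
    show "(F has_vector_derivative A x + B x) (at x)" if "0 < ereal x" for x
    proof -
      have "x > 0" using that by simp
      then have "(F has_real_derivative A x + B x) (at x)"
        unfolding F_def[abs_def]
        by (auto intro!: derivative_eq_intros weight_has_derivative simp: A_def B_def flow_op_def poly_monom field_simps power2_eq_square power3_eq_cube)
      then show ?thesis by (simp add: has_real_derivative_iff_has_vector_derivative)
    qed
    show "isCont (\<lambda>x. A x + B x) x" if "0 < ereal x" for x
    proof -
      have "x > 0" using that by simp
      then have "isCont (weight lam t) x" using weight_has_derivative DERIV_isCont by blast
      with \<open>x > 0\<close> show ?thesis unfolding A_def[abs_def] B_def[abs_def] by (intro continuous_intros) auto
    qed
    show "set_integrable lborel (einterval 0 \<infinity>) (\<lambda>x. A x + B x)"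
      using int by (simp add: zero_ereal_def)
    show "((F \<circ> real_of_ereal) \<longlongrightarrow> 0) (at_right 0)"
      using F_lims(1) unfolding zero_ereal_def ereal_tendsto_simps .
    show "((F \<circ> real_of_ereal) \<longlongrightarrow> 0) (at_left \<infinity>)"
      using F_lims(2) unfolding ereal_tendsto_simps .
  qed simp
  then have "(LINT x:{0<..}|lborel. A x + B x) = 0"
    by (simp add: interval_lebesgue_integral_0_infty)
  then have "(LINT x:{0<..}|lborel. A x) = - (LINT x:{0<..}|lborel. B x)"
    by (simp add: set_integral_add(2)[OF int])
  then show ?thesis unfolding A_def B_def set_integral_mult_right by simp
qed

lemma weighted_integral_has_derivative:
  assumes "lam > -1" "t > 0"
  shows "((\<lambda>s. LINT x:{0<..}|lborel. poly p x * weight lam s x) has_real_derivative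
            (LINT x:{0<..}|lborel. poly (flow_op lam p) x * weight lam t x) / t) (at t)"
  using moment_has_derivative_param[OF assms, of p] moment_integration_by_parts[OF assms, of p] assms(2)
  by simp

section \<open>Orthogonality and the three-term recurrence\<close>

text \<open>
  Only the values of the moment functional \<open>L p = \<integral> p w\<close> on polynomials matter, so the algebra is done
  for any linear functional with a sequence of monic orthogonal polynomials.
\<close>

locale orthogonal_recurrence =
  fixes L :: "real poly \<Rightarrow> real"
    and P :: "nat \<Rightarrow> real poly" and h \<alpha> \<beta> :: "nat \<Rightarrow> real"
  assumes L_add: "L (p + q) = L p + L q"
    and L_smult: "L (smult c p) = c * L p"
    and orth: "L (P m * P n) = (if m = n then h n else 0)"
    and degree_P [simp]: "degree (P n) = n"
    and lead_coeff_P: "lead_coeff (P n) = 1"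
    and h_pos: "h n > 0"
    and recurrence: "recurrence_coeffs P \<alpha> \<beta>"
begin

lemma L_0: "L 0 = 0"
  using L_smult[of 0 0] by simp

lemma L_diff: "L (p - q) = L p - L q"
  using L_add[of p "smult (-1) q"] L_smult[of "-1" q] by simp

lemma L_sum: "L (\<Sum>i\<in>A. f i) = (\<Sum>i\<in>A. L (f i))"
  by (induction A rule: infinite_finite_induct) (simp_all add: L_0 L_add)

lemma L_eq_sum_moments:
  assumes "degree p \<le> N"
  shows "L p = (\<Sum>i\<le>N. coeff p i * L (monom 1 i))"
proof -
  have "L p = L (\<Sum>i\<le>N. smult (coeff p i) (monom 1 i))"
    using poly_as_sum_of_monoms'[OF assms] by (simp add: smult_monom)
  then show ?thesis by (simp add: L_sum L_smult)
qed

lemma coeff_P_self [simp]: "coeff (P n) n = 1"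
  using lead_coeff_P[of n] by simp

lemma beta_0 [simp]: "\<beta> 0 = 0"
  using recurrence by (simp add: recurrence_coeffs_def)

lemma X_mult_P: "[:0, 1:] * P n = P (Suc n) + smult (\<alpha> n) (P n) + smult (\<beta> n) (P (n - 1))"
  using recurrence by (simp add: recurrence_coeffs_def)

lemma P_0: "P 0 = 1"
proof -
  obtain a where "P 0 = [:a:]" using degree_P[of 0] by (rule degree_eq_zeroE)
  then show ?thesis using coeff_P_self[of 0] by (simp add: one_pCons)
qed

text \<open>
  Subtracting the multiple of \<open>P\<^bsub>k\<^esub>\<close> with the same leading term lowers the degree \<open>k\<close> of \<open>q\<close>, so
  \<open>q\<close> is a combination of \<open>P\<^sub>0, \<dots>, P\<^bsub>m\<^esub>\<close>, in which only \<open>P\<^bsub>m\<^esub>\<close> contributes to the functional,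
  and it occurs with the coefficient of \<open>x\<^sup>m\<close> in \<open>q\<close>. This one fact is how orthogonality enters the
  differentiation of norms and coefficients.
\<close>

lemma L_mult_P_eq_coeff:
  assumes "degree q \<le> m"
  shows "L (q * P m) = coeff q m * h m"
  using assms
proof (induction "degree q" arbitrary: q rule: less_induct)
  case less
  define k c r where "k = degree q" and "c = lead_coeff q" and "r = q - smult c (P k)"
  have q: "q = smult c (P k) + r" by (simp add: r_def)
  have "degree r \<le> k" unfolding r_def
    by (rule degree_diff_le) (auto simp: k_def intro: order.trans[OF degree_smult_le])
  moreover have "coeff r k = 0" by (simp add: r_def c_def k_def)
  ultimately have r: "r = 0 \<or> degree r < k"
    by (metis le_neq_implies_less leading_coeff_0_iff)
  then have "L (r * P m) = 0"
    using less k_def by (auto simp: L_0 coeff_eq_0)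
  then have "L (q * P m) = (if k = m then c * h m else 0)"
    by (simp add: q distrib_right L_add L_smult orth)
  then show ?case using less.prems by (auto simp: k_def c_def coeff_eq_0)
qed

lemma h_Suc: "h (Suc n) = \<beta> (Suc n) * h n"
proof -
  have "L ([:0,1:] * P (Suc n) * P n) = \<beta> (Suc n) * h n"
    unfolding X_mult_P by (simp add: distrib_right L_add L_smult orth)
  moreover have "L ([:0,1:] * P n * P (Suc n)) = h (Suc n)"
    unfolding X_mult_P by (simp add: distrib_right L_add L_smult orth)
  ultimately show ?thesis by (simp only: mult.assoc mult.commute[of "P n"])
qed

lemma L_X_P_P: "L ([:0,1:] * P n * P n) = \<alpha> n * h n"
  unfolding X_mult_P by (cases n) (auto simp: distrib_right L_add L_smult orth)

text \<open>
  Comparing the coefficients of \<open>x\<^sup>n\<close> in the recurrence expresses \<open>\<alpha> n\<close> by the subleading coefficients of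
  two consecutive polynomials, whose derivatives in the parameter are easier to find.
\<close>

lemma alpha_eq_coeff_diff:
  assumes "n \<ge> 1"
  shows "\<alpha> n = coeff (P n) (n - 1) - coeff (P (Suc n)) n"
proof -
  have "coeff ([:0,1:] * P n) n = coeff (P (Suc n)) n + \<alpha> n"
    unfolding X_mult_P using assms by (simp add: coeff_eq_0)
  moreover have "coeff ([:0,1:] * P n) n = coeff (P n) (n - 1)"
    using assms by (cases n) auto
  ultimately show ?thesis by simp
qed

lemma X_X_mult_P:
  "[:0,1:] * ([:0,1:] * P n) =
     P (Suc (Suc n)) + smult (\<alpha> (Suc n) + \<alpha> n) (P (Suc n))
     + smult (\<beta> (Suc n) + (\<alpha> n)\<^sup>2 + \<beta> n) (P n)
     + smult (\<beta> n * (\<alpha> n + \<alpha> (n - 1))) (P (n - 1))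
     + smult (\<beta> n * \<beta> (n - 1)) (P (n - 2))"
proof -
  have "[:0,1:] * ([:0,1:] * P n) =
          [:0,1:] * (P (Suc n) + smult (\<alpha> n) (P n) + smult (\<beta> n) (P (n - 1)))"
    by (simp only: X_mult_P[of n])
  also have "\<dots> = [:0,1:] * P (Suc n) + smult (\<alpha> n) ([:0,1:] * P n)
          + smult (\<beta> n) ([:0,1:] * P (n - 1))"
    by (simp only: distrib_left mult_smult_right)
  also have "smult (\<beta> n) ([:0,1:] * P (n - 1)) = smult (\<beta> n) (P n + smult (\<alpha> (n - 1)) (P (n - 1)) + smult (\<beta> (n - 1)) (P (n - 2)))"
    by (subst X_mult_P, cases n) (auto simp: numeral_2_eq_2)
  finally show ?thesis
    unfolding X_mult_P
    by (simp add: smult_add_right smult_add_left algebra_simps power2_eq_square)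
qed

lemma monom_3: "monom 1 3 = [:0, 1:] * [:0, 1:] * [:0, 1 :: real:]"
  by (simp add: numeral_3_eq_3 monom_Suc)

text \<open>
  The three-term recurrence is multiplication by \<open>x\<close> as a tridiagonal matrix. The next two lemmas are
  entries of the cube of that matrix, computed by letting one factor \<open>x\<close> act on the second polynomial
  and two on the first.
\<close>

lemma L_X3_P_P:
  "L (monom 1 3 * (P n * P n)) =
     ((\<alpha> n) ^ 3 + \<beta> n * (2 * \<alpha> n + \<alpha> (n - 1)) + \<beta> (Suc n) * (2 * \<alpha> n + \<alpha> (Suc n))) * h n"
proof -
  have e: "monom 1 3 * (P n * P n) = ([:0,1:] * ([:0,1:] * P n)) * ([:0,1:] * P n)"
    unfolding monom_3 by (simp only: mult_ac)
  show ?thesis unfolding e unfolding X_X_mult_P unfolding X_mult_P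
    \<comment> \<open>For \<open>n \<le> 1\<close> the truncated indices \<open>n - 1\<close> and \<open>n - 2\<close> coincide with other ones, but those terms
      carry the factor \<open>\<beta> 0 = 0\<close>.\<close>
    by (cases n; cases "n - 1")
       (simp_all add: distrib_left L_add L_smult orth h_Suc algebra_simps power2_eq_square power3_eq_cube)
qed

lemma L_X3_P_P_Suc:
  "L (monom 1 3 * (P (Suc n) * P n)) =
     \<beta> (Suc n) * ((\<alpha> (Suc n))\<^sup>2 + \<alpha> (Suc n) * \<alpha> n + (\<alpha> n)\<^sup>2
                  + \<beta> (Suc (Suc n)) + \<beta> (Suc n) + \<beta> n) * h n"
proof -
  have e: "monom 1 3 * (P (Suc n) * P n) = ([:0,1:] * ([:0,1:] * P (Suc n))) * ([:0,1:] * P n)"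
    unfolding monom_3 by (simp only: mult_ac)
  show ?thesis unfolding e unfolding X_X_mult_P unfolding X_mult_P
    \<comment> \<open>For \<open>n \<le> 1\<close> the truncated indices \<open>n - 1\<close> and \<open>n - 2\<close> coincide with other ones, but those terms
      carry the factor \<open>\<beta> 0 = 0\<close>.\<close>
    by (cases n; cases "n - 1")
       (simp_all add: distrib_left L_add L_smult orth h_Suc algebra_simps power2_eq_square power3_eq_cube)
qed

end

section \<open>Polynomials depending on a parameter\<close>

text \<open>
  Derivative of a family of polynomials in its parameter, as opposed to \<open>pderiv\<close>, which is the derivative in
  the indeterminate.
\<close>

definition has_coeff_derivative :: "(real \<Rightarrow> real poly) \<Rightarrow> real poly \<Rightarrow> real \<Rightarrow> bool" where
  "has_coeff_derivative Q Q' t \<longleftrightarrow>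
     (\<forall>i. ((\<lambda>s. coeff (Q s) i) has_real_derivative coeff Q' i) (at t))"

lemma has_coeff_derivative_const: "has_coeff_derivative (\<lambda>_. q) 0 t"
  by (simp add: has_coeff_derivative_def)

lemma has_coeff_derivative_diff:
  "has_coeff_derivative Q Q' t \<Longrightarrow> has_coeff_derivative R R' t \<Longrightarrow>
     has_coeff_derivative (\<lambda>s. Q s - R s) (Q' - R') t"
  by (auto simp: has_coeff_derivative_def intro!: derivative_intros)

lemma has_coeff_derivative_smult:
  "(c has_real_derivative c') (at t) \<Longrightarrow> has_coeff_derivative Q Q' t \<Longrightarrow>
     has_coeff_derivative (\<lambda>s. smult (c s) (Q s)) (smult c' (Q t) + smult (c t) Q') t"
  by (auto simp: has_coeff_derivative_def algebra_simps intro!: derivative_eq_intros)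

lemma has_coeff_derivative_mult:
  assumes "has_coeff_derivative Q Q' t" "has_coeff_derivative R R' t"
  shows "has_coeff_derivative (\<lambda>s. Q s * R s) (Q' * R t + Q t * R') t"
  unfolding has_coeff_derivative_def
proof
  fix i
  have "coeff (Q' * R t + Q t * R') i =
      (\<Sum>j\<le>i. coeff Q' j * coeff (R t) (i - j) + coeff R' (i - j) * coeff (Q t) j)"
    by (simp only: coeff_add coeff_mult sum.distrib) (simp only: mult.commute)
  then show "((\<lambda>s. coeff (Q s * R s) i) has_real_derivative coeff (Q' * R t + Q t * R') i) (at t)"
    using assms unfolding coeff_mult has_coeff_derivative_def
    by (auto intro!: DERIV_sum DERIV_mult)
qed

lemma has_real_derivative_transform_pos:
  fixes f g :: "real \<Rightarrow> real"
  assumes "(g has_real_derivative D) (at t)" "t > 0" "\<And>s. s > 0 \<Longrightarrow> f s = g s"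
  shows "(f has_real_derivative D) (at t)"
  using assms(1) open_greaterThan
  by (rule has_field_derivative_transform_within_open) (use assms in auto)

lemma has_coeff_derivative_transform_pos:
  assumes "has_coeff_derivative R D t" "t > 0" "\<And>s. s > 0 \<Longrightarrow> Q s = R s"
  shows "has_coeff_derivative Q D t"
  unfolding has_coeff_derivative_def
  using assms by (auto simp: has_coeff_derivative_def intro: has_real_derivative_transform_pos)

lemma coeff_derivative_eq_0:
  assumes "has_coeff_derivative Q Q' t" "t > 0" "\<And>s. s > 0 \<Longrightarrow> coeff (Q s) i = c"
  shows "coeff Q' i = 0"
proof -
  have "((\<lambda>s. coeff (Q s) i) has_real_derivative coeff Q' i) (at t)"
    using assms(1) by (simp add: has_coeff_derivative_def)
  moreover have "((\<lambda>s. coeff (Q s) i) has_real_derivative 0) (at t)"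
    using DERIV_const assms(2,3) by (rule has_real_derivative_transform_pos)
  ultimately show ?thesis by (rule DERIV_unique)
qed

text \<open>
  The functionals \<open>L s\<close> now move with the parameter, with velocity given by the flow operator. The
  hypotheses concern positive parameters only, whence the transfer lemmas above.
\<close>

locale moment_flow =
  fixes lam :: real and L :: "real \<Rightarrow> real poly \<Rightarrow> real"
    and P :: "nat \<Rightarrow> real \<Rightarrow> real poly" and h \<alpha> \<beta> :: "nat \<Rightarrow> real \<Rightarrow> real"
  assumes orthogonal: "s > 0 \<Longrightarrow> orthogonal_recurrence (L s) (\<lambda>k. P k s) (\<lambda>k. h k s) (\<lambda>k. \<alpha> k s) (\<lambda>k. \<beta> k s)"
    and flow: "s > 0 \<Longrightarrow> ((\<lambda>u. L u p) has_real_derivative L s (flow_op lam p) / s) (at s)"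
begin

text \<open>
  A product rule: the functional and its argument both move. The uniform degree bound makes the expansion
  in moments a finite sum with a fixed range.
\<close>

lemma L_has_derivative:
  assumes t: "t > 0" and Q: "has_coeff_derivative Q Q' t"
    and deg: "\<And>s. s > 0 \<Longrightarrow> degree (Q s) \<le> N"
  shows "((\<lambda>s. L s (Q s)) has_real_derivative L t Q' + L t (flow_op lam (Q t)) / t) (at t)"
proof -
  interpret orthogonal_recurrence "L t" "\<lambda>k. P k t" "\<lambda>k. h k t" "\<lambda>k. \<alpha> k t" "\<lambda>k. \<beta> k t"
    using orthogonal t .
  have "coeff Q' i = 0" if "i > N" for i
    using Q t
  proof (rule coeff_derivative_eq_0)
    show "coeff (Q s) i = 0" if "s > 0" for s
      using deg[OF that] \<open>i > N\<close> by (simp add: coeff_eq_0)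
  qed
  then have deg': "degree Q' \<le> N" by (auto intro: degree_le)
  have expand: "L s (Q s) = (\<Sum>i\<le>N. coeff (Q s) i * L s (monom 1 i))" if "s > 0" for s
    using orthogonal_recurrence.L_eq_sum_moments[OF orthogonal[OF that] deg[OF that]] .
  have "L t (flow_op lam (Q t)) = L t (flow_op lam (\<Sum>i\<le>N. smult (coeff (Q t) i) (monom 1 i)))"
    using poly_as_sum_of_monoms'[OF deg[OF t]] by (simp add: smult_monom)
  also have "\<dots> = (\<Sum>i\<le>N. coeff (Q t) i * L t (flow_op lam (monom 1 i)))"
    by (simp only: flow_op_sum flow_op_smult L_sum L_smult)
  finally have D: "L t Q' + L t (flow_op lam (Q t)) / t =
      (\<Sum>i\<le>N. coeff Q' i * L t (monom 1 i) + L t (flow_op lam (monom 1 i)) / t * coeff (Q t) i)"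
    by (simp add: L_eq_sum_moments[OF deg'] sum.distrib sum_divide_distrib mult_ac)
  have "((\<lambda>s. \<Sum>i\<le>N. coeff (Q s) i * L s (monom 1 i)) has_real_derivative
      L t Q' + L t (flow_op lam (Q t)) / t) (at t)"
    unfolding D using Q by (intro DERIV_sum DERIV_mult flow t) (simp add: has_coeff_derivative_def)
  then show ?thesis using t expand by (rule has_real_derivative_transform_pos)
qed

lemma L_mult_has_derivative:
  assumes t: "t > 0" and Q: "has_coeff_derivative Q Q' t" and R: "has_coeff_derivative R R' t"
    and deg: "\<And>s. s > 0 \<Longrightarrow> degree (Q s) \<le> M" "\<And>s. s > 0 \<Longrightarrow> degree (R s) \<le> N"
  shows "((\<lambda>s. L s (Q s * R s)) has_real_derivative
            L t (Q' * R t + Q t * R') + L t (flow_op lam (Q t * R t)) / t) (at t)"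
  using t has_coeff_derivative_mult[OF Q R]
proof (rule L_has_derivative)
  show "degree (Q s * R s) \<le> M + N" if "s > 0" for s
    using deg[OF that] degree_mult_le[of "Q s" "R s"] by linarith
qed

lemma P_zero_eq: "s > 0 \<Longrightarrow> P 0 s = 1"
  using orthogonal_recurrence.P_0[OF orthogonal] .

lemma degree_P_eq: "s > 0 \<Longrightarrow> degree (P n s) = n"
  using orthogonal_recurrence.degree_P[OF orthogonal] .

lemma h_positive: "s > 0 \<Longrightarrow> h n s > 0"
  using orthogonal_recurrence.h_pos[OF orthogonal] .

lemma h_eq: "s > 0 \<Longrightarrow> h n s = L s (P n s * P n s)"
  using orthogonal_recurrence.orth[OF orthogonal, of s n n] by simp

lemma alpha_eq: "s > 0 \<Longrightarrow> \<alpha> n s = L s (([:0, 1:] * P n s) * P n s) / h n s"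
  using orthogonal_recurrence.L_X_P_P[OF orthogonal, of s n] h_positive[of s n] by simp

lemma beta_Suc_eq: "s > 0 \<Longrightarrow> \<beta> (Suc n) s = h (Suc n) s / h n s"
  using orthogonal_recurrence.h_Suc[OF orthogonal, of s n] h_positive[of s n] by simp

lemma h_differentiable:
  assumes "t > 0" "has_coeff_derivative (P n) P' t"
  shows "\<exists>D. (h n has_real_derivative D) (at t)"
proof -
  have "\<exists>D. ((\<lambda>s. L s (P n s * P n s)) has_real_derivative D) (at t)"
    using L_mult_has_derivative[OF assms(1) assms(2) assms(2), of n n] degree_P_eq by auto
  then show ?thesis using assms(1) h_eq by (blast intro: has_real_derivative_transform_pos)
qed

lemma beta_differentiable:
  assumes t: "t > 0" and "has_coeff_derivative (P n) P' t" "has_coeff_derivative (P (Suc n)) P'' t"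
  shows "\<exists>D. (\<beta> (Suc n) has_real_derivative D) (at t)"
proof -
  obtain D1 D2 where "(h n has_real_derivative D1) (at t)" "(h (Suc n) has_real_derivative D2) (at t)"
    using h_differentiable assms by blast
  then have "((\<lambda>s. h (Suc n) s / h n s) has_real_derivative
                (D2 * h n t - h (Suc n) t * D1) / (h n t * h n t)) (at t)"
    using h_positive[OF t, of n] by (intro DERIV_divide) auto
  then show ?thesis using t beta_Suc_eq by (blast intro: has_real_derivative_transform_pos)
qed

lemma alpha_differentiable:
  assumes t: "t > 0" and P': "has_coeff_derivative (P n) P' t"
  shows "\<exists>D. (\<alpha> n has_real_derivative D) (at t)"
proof -
  obtain D1 where D1: "(h n has_real_derivative D1) (at t)"
    using h_differentiable assms by blast
  have "degree ([:0, 1:] * P n s) \<le> Suc n" if "s > 0" for s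
    using degree_mult_le[of "[:0,1:]" "P n s"] degree_P_eq[OF that] by simp
  then obtain D2 where D2: "((\<lambda>s. L s (([:0, 1:] * P n s) * P n s)) has_real_derivative D2) (at t)"
    using L_mult_has_derivative[OF t has_coeff_derivative_mult[OF has_coeff_derivative_const P'] P',
        of "[:0, 1:]" "Suc n" n] degree_P_eq
    by (simp only: order_refl) blast
  have "((\<lambda>s. L s (([:0, 1:] * P n s) * P n s) / h n s) has_real_derivative
      (D2 * h n t - L t (([:0, 1:] * P n t) * P n t) * D1) / (h n t * h n t)) (at t)"
    using h_positive[OF t, of n] by (intro DERIV_divide D1 D2) simp
  then show ?thesis using t alpha_eq by (blast intro: has_real_derivative_transform_pos)
qed

text \<open>
  The recurrence produces \<open>P (m + 1)\<close> from \<open>P m\<close> and \<open>P (m - 1)\<close>, and its coefficients \<open>\<alpha> m\<close>, \<open>\<beta> m\<close> are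
  quotients of moments of these same polynomials. So differentiability passes from lower to higher index.
\<close>

lemma P_differentiable:
  assumes t: "t > 0"
  shows "\<exists>P'. has_coeff_derivative (P n) P' t"
proof (induction n rule: less_induct)
  case (less n)
  show ?case
  proof (cases n)
    case 0
    then show ?thesis
      using has_coeff_derivative_transform_pos[OF has_coeff_derivative_const t, of "P 0" 1] P_zero_eq
      by auto
  next
    case (Suc m)
    obtain Q' where Q': "has_coeff_derivative (P m) Q' t" using less.IH[of m] Suc by auto
    obtain R' where R': "has_coeff_derivative (P (m - 1)) R' t" using less.IH[of "m - 1"] Suc by force
    obtain a' where a': "(\<alpha> m has_real_derivative a') (at t)"
      using alpha_differentiable[OF t Q'] by blast
    have "\<exists>b'. (\<beta> m has_real_derivative b') (at t)"
    proof (cases m)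
      case 0
      then have "\<beta> m s = 0" if "s > 0" for s
        using orthogonal_recurrence.beta_0[OF orthogonal[OF that]] by simp
      then show ?thesis using has_real_derivative_transform_pos[OF DERIV_const t] by blast
    next
      case (Suc k)
      then show ?thesis using beta_differentiable[OF t, of k] Q' R' by auto
    qed
    then obtain b' where b': "(\<beta> m has_real_derivative b') (at t)" by blast
    have rec: "P n s = [:0, 1:] * P m s - smult (\<alpha> m s) (P m s) - smult (\<beta> m s) (P (m - 1) s)"
      if "s > 0" for s
      using orthogonal_recurrence.X_mult_P[OF orthogonal[OF that], of m] Suc by simp
    show ?thesis
      using t rec has_coeff_derivative_diff[OF has_coeff_derivative_diff[OF
          has_coeff_derivative_mult[OF has_coeff_derivative_const Q'] has_coeff_derivative_smult[OF a' Q']]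
          has_coeff_derivative_smult[OF b' R']]
      by (blast intro: has_coeff_derivative_transform_pos)
  qed
qed

lemma L_flow_op:
  assumes "t > 0"
  shows "L t (flow_op lam (p * q)) =
    (lam + 1) * L t (p * q) + L t (([:0, 1:] * pderiv p) * q) + L t (([:0, 1:] * pderiv q) * p)
      - 3 * L t (monom 1 3 * (p * q))"
proof -
  have "flow_op lam (p * q) = smult (lam + 1) (p * q) + ([:0, 1:] * pderiv p) * q + ([:0, 1:] * pderiv q) * p
      - smult 3 (monom 1 3 * (p * q))"
    unfolding flow_op_def pderiv_mult by (simp only: distrib_left mult_ac add_ac)
  then show ?thesis
    by (simp only: orthogonal_recurrence.L_add[OF orthogonal[OF assms]] orthogonal_recurrence.L_diff[OF orthogonal[OF assms]]
        orthogonal_recurrence.L_smult[OF orthogonal[OF assms]])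
qed

text \<open>
  As the leading coefficient is constantly \<open>1\<close>, the parameter derivative of \<open>P n\<close> has degree less than \<open>n\<close>
  and is orthogonal to every \<open>P m\<close> with \<open>m \<ge> n\<close>.
\<close>

lemma P_derivative_coeff_eq_0:
  assumes t: "t > 0" and P': "has_coeff_derivative (P n) P' t" and "n \<le> i"
  shows "coeff P' i = 0"
  using P' t
proof (rule coeff_derivative_eq_0)
  show "coeff (P n s) i = (if i = n then 1 else 0)" if "s > 0" for s
    using orthogonal_recurrence.coeff_P_self[OF orthogonal[OF that], of n] degree_P_eq[OF that, of n] \<open>n \<le> i\<close>
    by (auto simp: coeff_eq_0)
qed

lemma L_P_derivative_mult:
  assumes t: "t > 0" and P': "has_coeff_derivative (P n) P' t" and "n \<le> Suc m"
  shows "L t (P' * P m t) = coeff P' m * h m t"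
  using P_derivative_coeff_eq_0[OF t P'] \<open>n \<le> Suc m\<close>
  by (intro orthogonal_recurrence.L_mult_P_eq_coeff[OF orthogonal[OF t]] degree_le) auto

lemma P_derivative_orthogonal:
  assumes "t > 0" "has_coeff_derivative (P n) P' t" "n \<le> m"
  shows "L t (P' * P m t) = 0"
  using L_P_derivative_mult[OF assms(1,2), of m] P_derivative_coeff_eq_0[OF assms] assms(3) by simp

text \<open>
  In the derivative of \<open>L (P n * P n)\<close> the motion of \<open>P n\<close> drops out by orthogonality, and only the
  motion of the functional remains. There the Euler operator \<open>x d/dx\<close> multiplies the leading term by \<open>n\<close>.
\<close>

lemma h_has_derivative:
  assumes t: "t > 0"
  shows "(h n has_real_derivative
     ((lam + 1 + 2 * real n) * h n t - 3 * L t (monom 1 3 * (P n t * P n t))) / t) (at t)"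
proof -
  interpret orthogonal_recurrence "L t" "\<lambda>k. P k t" "\<lambda>k. h k t" "\<lambda>k. \<alpha> k t" "\<lambda>k. \<beta> k t"
    using orthogonal t .
  obtain P' where P': "has_coeff_derivative (P n) P' t" using P_differentiable[OF t] ..
  have "L t (P' * P n t + P n t * P') = 0"
    using P_derivative_orthogonal[OF t P', of n]
    unfolding mult.commute[of "P n t" P'] L_add by simp
  moreover have "L t ([:0, 1:] * pderiv (P n t) * P n t) = n * h n t"
    using degree_X_pderiv[of "P n t"] by (subst L_mult_P_eq_coeff) (simp_all only: coeff_X_pderiv coeff_P_self degree_P_eq[OF t])
  ultimately have "L t (P' * P n t + P n t * P') + L t (flow_op lam (P n t * P n t)) / t =
      ((lam + 1 + 2 * real n) * h n t - 3 * L t (monom 1 3 * (P n t * P n t))) / t"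
    by (simp only: L_flow_op[OF t]) (simp add: orth algebra_simps)
  with L_mult_has_derivative[OF t P' P', of n n] degree_P_eq
  have "((\<lambda>s. L s (P n s * P n s)) has_real_derivative
     ((lam + 1 + 2 * real n) * h n t - 3 * L t (monom 1 3 * (P n t * P n t))) / t) (at t)"
    by simp
  then show ?thesis using t h_eq by (rule has_real_derivative_transform_pos)
qed

text \<open>
  The relation \<open>L (P (n + 1) * P n) = 0\<close> holds for all parameters. In its derivative the motion of \<open>P (n + 1)\<close>
  is visible only through the subleading coefficient, which can therefore be solved for.
\<close>

lemma subleading_has_derivative:
  assumes t: "t > 0"
  shows "((\<lambda>s. coeff (P (Suc n) s) n) has_real_derivative
     (coeff (P (Suc n) t) n + 3 * L t (monom 1 3 * (P (Suc n) t * P n t)) / h n t) / t) (at t)"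
proof -
  interpret orthogonal_recurrence "L t" "\<lambda>k. P k t" "\<lambda>k. h k t" "\<lambda>k. \<alpha> k t" "\<lambda>k. \<beta> k t"
    using orthogonal t .
  obtain P' where P': "has_coeff_derivative (P (Suc n)) P' t" using P_differentiable[OF t] ..
  obtain Q' where Q': "has_coeff_derivative (P n) Q' t" using P_differentiable[OF t] ..
  define c where "c = coeff (P (Suc n) t) n"
  have Q'_orth: "L t (P (Suc n) t * Q') = 0"
    using P_derivative_orthogonal[OF t Q', of "Suc n"] by (simp add: mult.commute)
  have P'_coeff: "L t (P' * P n t) = coeff P' n * h n t"
    using L_P_derivative_mult[OF t P'] by simp
  \<comment> \<open>By Euler's relation \<open>r\<close> has no term in \<open>x\<^bsup>n+1\<^esup>\<close>, and its coefficient of \<open>x\<^sup>n\<close> is \<open>n - (n + 1) = -1\<close>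
    times the subleading coefficient.\<close>
  define r where "r = [:0, 1:] * pderiv (P (Suc n) t) - smult (Suc n) (P (Suc n) t)"
  have euler: "[:0, 1:] * pderiv (P (Suc n) t) = smult (Suc n) (P (Suc n) t) + r"
    by (simp add: r_def)
  have r_coeff: "coeff r i = (real i - real (Suc n)) * coeff (P (Suc n) t) i" for i
    by (simp only: r_def coeff_diff coeff_X_pderiv coeff_smult left_diff_distrib)
  have "degree r \<le> n"
  proof (intro degree_le allI impI)
    show "coeff r i = 0" if "n < i" for i
      using that by (cases "i = Suc n") (simp_all add: r_coeff coeff_eq_0)
  qed
  moreover have "coeff r n = - c" by (simp add: r_coeff c_def)
  ultimately have "L t (r * P n t) = - c * h n t" by (simp add: L_mult_P_eq_coeff)
  then have 1: "L t ([:0, 1:] * pderiv (P (Suc n) t) * P n t) = - c * h n t"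
    unfolding euler by (simp add: distrib_right L_add L_smult orth)
  have 2: "L t ([:0, 1:] * pderiv (P n t) * P (Suc n) t) = 0"
    using degree_X_pderiv[of "P n t"]
    by (subst L_mult_P_eq_coeff) (auto simp only: coeff_X_pderiv degree_P_eq[OF t] coeff_eq_0 lessI)
  have "((\<lambda>s. L s (P (Suc n) s * P n s)) has_real_derivative 0) (at t)"
    using DERIV_const t
    by (rule has_real_derivative_transform_pos) (simp add: orthogonal_recurrence.orth[OF orthogonal])
  moreover have "((\<lambda>s. L s (P (Suc n) s * P n s)) has_real_derivative
      L t (P' * P n t + P (Suc n) t * Q') + L t (flow_op lam (P (Suc n) t * P n t)) / t) (at t)"
    using L_mult_has_derivative[OF t P' Q', of "Suc n" n] degree_P_eq by simp
  ultimately have "L t (P' * P n t + P (Suc n) t * Q') + L t (flow_op lam (P (Suc n) t * P n t)) / t = 0"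
    by (metis DERIV_unique)
  then have "coeff P' n * h n t + (- c * h n t - 3 * L t (monom 1 3 * (P (Suc n) t * P n t))) / t = 0"
    by (simp only: L_flow_op[OF t] L_add P'_coeff Q'_orth 1 2) (simp add: orth)
  then have "coeff P' n = (c + 3 * L t (monom 1 3 * (P (Suc n) t * P n t)) / h n t) / t"
    using t h_pos[of n] by (simp add: field_simps)
  then show ?thesis using P' unfolding has_coeff_derivative_def c_def by metis
qed

text \<open>
  The terms \<open>3 \<beta>\<^bsub>n\<^esub> \<beta>\<^bsub>n+1\<^esub>\<close> from the two matrix entries cancel.
\<close>

lemma alpha_has_derivative:
  assumes t: "t > 0" and n: "n \<ge> 1"
  shows "(\<alpha> n has_real_derivative
      (\<alpha> n t
      + 3 * \<beta> n t * ((\<alpha> n t)\<^sup>2 + \<alpha> n t * \<alpha> (n - 1) t + (\<alpha> (n - 1) t)\<^sup>2 + \<beta> n t + \<beta> (n - 1) t)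
      - 3 * \<beta> (n + 1) t * ((\<alpha> (n + 1) t)\<^sup>2 + \<alpha> (n + 1) t * \<alpha> n t + (\<alpha> n t)\<^sup>2
                            + \<beta> (n + 2) t + \<beta> (n + 1) t)) / t) (at t)" (is "(_ has_real_derivative ?D) _")
proof -
  interpret orthogonal_recurrence "L t" "\<lambda>k. P k t" "\<lambda>k. h k t" "\<lambda>k. \<alpha> k t" "\<lambda>k. \<beta> k t"
    using orthogonal t .
  obtain m where m: "n = Suc m" using n by (cases n) auto
  have ev: "\<alpha> n s = coeff (P n s) m - coeff (P (Suc n) s) n" if "s > 0" for s
    using orthogonal_recurrence.alpha_eq_coeff_diff[OF orthogonal[OF that] n] m by simp
  have "(\<alpha> n has_real_derivative
      (coeff (P (Suc m) t) m + 3 * L t (monom 1 3 * (P (Suc m) t * P m t)) / h m t) / t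
      - (coeff (P (Suc n) t) n + 3 * L t (monom 1 3 * (P (Suc n) t * P n t)) / h n t) / t) (at t)"
    using DERIV_diff[OF subleading_has_derivative[OF t, of m] subleading_has_derivative[OF t, of n]] t
    by (rule has_real_derivative_transform_pos) (simp add: ev[unfolded m] m)
  moreover have "(coeff (P (Suc m) t) m + 3 * L t (monom 1 3 * (P (Suc m) t * P m t)) / h m t) / t
      - (coeff (P (Suc n) t) n + 3 * L t (monom 1 3 * (P (Suc n) t * P n t)) / h n t) / t = ?D"
  proof -
    have "coeff (P (Suc m) t) m = \<alpha> n t + coeff (P (Suc n) t) n"
      using ev[OF t] m by simp
    then show ?thesis
      using t h_pos[of m] h_pos[of n] unfolding m L_X3_P_P_Suc by (simp add: field_simps)
  qed
  ultimately show ?thesis by simp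
qed

text \<open>
  Logarithmic differentiation of \<open>\<beta> n = h n / h (n - 1)\<close>: the constant \<open>lam + 1\<close> cancels, and the Euler terms
  \<open>2 n\<close> and \<open>2 (n - 1)\<close> leave the summand \<open>2\<close>.
\<close>

lemma beta_has_derivative:
  assumes t: "t > 0" and n: "n \<ge> 1"
  shows "(\<beta> n has_real_derivative
      (\<beta> n t * (2 + 3 * \<alpha> (n - 2) t * \<beta> (n - 1) t - 3 * \<alpha> (n + 1) t * \<beta> (n + 1) t
        + 3 * \<alpha> (n - 1) t * ((\<alpha> (n - 1) t)\<^sup>2 + \<beta> n t + 2 * \<beta> (n - 1) t)
        - 3 * \<alpha> n t * ((\<alpha> n t)\<^sup>2 + \<beta> n t + 2 * \<beta> (n + 1) t))) / t) (at t)" (is "(_ has_real_derivative ?D) _")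
proof -
  interpret orthogonal_recurrence "L t" "\<lambda>k. P k t" "\<lambda>k. h k t" "\<lambda>k. \<alpha> k t" "\<lambda>k. \<beta> k t"
    using orthogonal t .
  obtain m where m: "n = Suc m" using n by (cases n) auto
  let ?d = "\<lambda>n. ((lam + 1 + 2 * real n) * h n t - 3 * L t (monom 1 3 * (P n t * P n t))) / t"
  have "(\<beta> n has_real_derivative (?d n * h m t - h n t * ?d m) / (h m t * h m t)) (at t)"
  proof (rule has_real_derivative_transform_pos[OF _ t])
    show "\<beta> n s = h n s / h m s" if "s > 0" for s
      using beta_Suc_eq[OF that] m by simp
    show "((\<lambda>s. h n s / h m s) has_real_derivative
            (?d n * h m t - h n t * ?d m) / (h m t * h m t)) (at t)"
      using h_pos[of m] by (intro DERIV_divide h_has_derivative t) simp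
  qed
  moreover have "(?d n * h m t - h n t * ?d m) / (h m t * h m t) = ?D"
    using t h_pos[of m] unfolding L_X3_P_P unfolding m h_Suc
    by (simp add: numeral_2_eq_2[symmetric] field_simps power2_eq_square power3_eq_cube)
  ultimately show ?thesis by simp
qed

end

section \<open>The differential-difference equations\<close>

lemma moment_flow_weight:
  assumes lam: "lam > -1"
    and P: "\<And>s. s > 0 \<Longrightarrow> monic_orthogonal_polys (weight lam s) (\<lambda>k. P k s) (\<lambda>k. h k s)"
    and rec: "\<And>s. s > 0 \<Longrightarrow> recurrence_coeffs (\<lambda>k. P k s) (\<lambda>k. \<alpha> k s) (\<lambda>k. \<beta> k s)"
  shows "moment_flow lam (\<lambda>s p. LINT x:{0<..}|lborel. poly p x * weight lam s x) P h \<alpha> \<beta>"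
proof (rule moment_flow.intro)
  fix s :: real assume s: "s > 0"
  note int = set_integrable_poly_weight[OF lam s]
  note orth = P[OF s, unfolded monic_orthogonal_polys_def]
  show "orthogonal_recurrence (\<lambda>p. LINT x:{0<..}|lborel. poly p x * weight lam s x)
          (\<lambda>k. P k s) (\<lambda>k. h k s) (\<lambda>k. \<alpha> k s) (\<lambda>k. \<beta> k s)"
  proof
    show "(LINT x:{0<..}|lborel. poly (p + q) x * weight lam s x) =
        (LINT x:{0<..}|lborel. poly p x * weight lam s x) + (LINT x:{0<..}|lborel. poly q x * weight lam s x)" for p q
      using set_integral_add(2)[OF int int, of p q] by (simp add: distrib_right)
    show "(LINT x:{0<..}|lborel. poly (smult c p) x * weight lam s x) =
        c * (LINT x:{0<..}|lborel. poly p x * weight lam s x)" for c p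
      by (simp add: mult.assoc)
    show "lead_coeff (P n s) = 1" for n using orth by blast
  qed (use orth rec[OF s] in \<open>simp_all add: poly_mult\<close>)
  show "((\<lambda>u. LINT x:{0<..}|lborel. poly p x * weight lam u x) has_real_derivative
          (LINT x:{0<..}|lborel. poly (flow_op lam p) x * weight lam s x) / s) (at s)" for p
    using weighted_integral_has_derivative[OF lam s] .
qed

theorem theorem3p1:
  fixes lam :: real
    and P :: "nat \<Rightarrow> real \<Rightarrow> real poly"
    and h \<alpha> \<beta> :: "nat \<Rightarrow> real \<Rightarrow> real"
    and n :: nat and t :: real
  assumes "lam > -1"
    and "\<And>s. s > 0 \<Longrightarrow>
           monic_orthogonal_polys (weight lam s) (\<lambda>k. P k s) (\<lambda>k. h k s)"
    and "\<And>s. s > 0 \<Longrightarrow>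
           recurrence_coeffs (\<lambda>k. P k s) (\<lambda>k. \<alpha> k s) (\<lambda>k. \<beta> k s)"
    and "n \<ge> 1" and "t > 0"
  shows "\<alpha> n field_differentiable at t \<and> \<beta> n field_differentiable at t \<and>
    t * deriv (\<alpha> n) t =
      \<alpha> n t
      + 3 * \<beta> n t * ((\<alpha> n t)\<^sup>2 + \<alpha> n t * \<alpha> (n - 1) t + (\<alpha> (n - 1) t)\<^sup>2 + \<beta> n t + \<beta> (n - 1) t)
      - 3 * \<beta> (n + 1) t * ((\<alpha> (n + 1) t)\<^sup>2 + \<alpha> (n + 1) t * \<alpha> n t + (\<alpha> n t)\<^sup>2
                            + \<beta> (n + 2) t + \<beta> (n + 1) t) \<and>
    t * deriv (\<beta> n) t =
      \<beta> n t * (2 + 3 * \<alpha> (n - 2) t * \<beta> (n - 1) t - 3 * \<alpha> (n + 1) t * \<beta> (n + 1) t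
        + 3 * \<alpha> (n - 1) t * ((\<alpha> (n - 1) t)\<^sup>2 + \<beta> n t + 2 * \<beta> (n - 1) t)
        - 3 * \<alpha> n t * ((\<alpha> n t)\<^sup>2 + \<beta> n t + 2 * \<beta> (n + 1) t))"
proof -
  interpret moment_flow lam "\<lambda>s p. LINT x:{0<..}|lborel. poly p x * weight lam s x" P h \<alpha> \<beta>
    using assms(1-3) by (rule moment_flow_weight)
  note derivs = alpha_has_derivative[OF assms(5,4)] beta_has_derivative[OF assms(5,4)]
  show ?thesis
    using assms(5) DERIV_imp_deriv[OF derivs(1)] DERIV_imp_deriv[OF derivs(2)] derivs
    by (auto simp only: field_differentiable_def nonzero_mult_div_cancel_left times_divide_eq_right)
qed

end
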